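(* For every even $\alpha\ge 0$ and every $\beta\ge 0$ there exists a $\mathbb{Z}_2R$ linear self-dual code $\mathcal{C}\subseteq\mathbb{Z}_2^\alpha\times R^\beta$ (of type $(\alpha,\beta;\gamma,\delta;\kappa)$ for some $\gamma,\delta,\kappa$).
   Context: Let $R=\mathbb{Z}_2+u\mathbb{Z}_2=\{0,1,u,1+u\}$ with $u^2=0$, and $\eta:R\to\mathbb{Z}_2$, $\eta(r+uq)=r$. The set $\mathbb{Z}_2^\alpha\times R^\beta$ is an $R$-module under $d(a_1,\dots,a_\alpha\mid b_1,\dots,b_\beta)=(\eta(d)a_1,\dots,\eta(d)a_\alpha\mid db_1,\dots,db_\beta)$. A $\mathbb{Z}_2R$ linear code is an $R$-submodule $\mathcal{C}$ of $\mathbb{Z}_2^\alpha\times R^\beta$. It has type $(\alpha,\beta;\gamma,\delta;\kappa)$ if $\mathcal{C}\cong(R/uR)^\gamma\oplus R^\delta$ as an $R$-module and $\kappa=\dim_{\mathbb{Z}_2}(\mathcal{C}_b)_X$, where $\mathcal{C}_b$ is the subcode of codewords whose last $\beta$ coordinates all lie in $\{0,u\}$ and $(\cdot)_X$ denotes projection onto the first $\alpha$ coordinates ($\kappa=0$ if $\alpha=0$); every linear code has a type. The inner product is $\langle(\mathbf v|\mathbf w),(\mathbf x|\mathbf y)\rangle=u\sum_{i=1}^\alpha v_ix_i+\sum_{j=1}^\beta w_jy_j\in R$; $\mathcal{C}^\perp$ is the set of vectors orthogonal to all of $\mathcal{C}$; $\mathcal{C}$ is self-dual if $\mathcal{C}=\mathcal{C}^\perp$.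 *)

theory Defs
  imports "Jordan_Normal_Form.VS_Connect" "HOL-Library.Z2" "HOL-Algebra.QuotRing"
begin

section \<open>The ring \<open>R = \<int>\<^sub>2 + u\<int>\<^sub>2\<close> with \<open>u\<^sup>2 = 0\<close>\<close>

text \<open>\<open>Z2U r q\<close> stands for \<open>r + uq\<close>.\<close>

datatype z2u = Z2U (eta: bit) (ucoeff: bit)

instantiation z2u :: comm_ring_1
begin

definition "0 = Z2U 0 0"
definition "1 = Z2U 1 0"
definition "x + y = Z2U (eta x + eta y) (ucoeff x + ucoeff y)"
definition "- x = Z2U (- eta x) (- ucoeff x)"
definition "x - y = Z2U (eta x - eta y) (ucoeff x - ucoeff y)"
definition "x * y = Z2U (eta x * eta y) (eta x * ucoeff y + ucoeff x * eta y)"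

instance
  by standard
    (simp_all add: zero_z2u_def one_z2u_def plus_z2u_def uminus_z2u_def minus_z2u_def
      times_z2u_def algebra_simps del: add_bit_eq_xor mult_bit_eq_and)

end

definition u\<^sub>R :: z2u where "u\<^sub>R = Z2U 0 1"

definition of_Z2 :: "bit \<Rightarrow> z2u" where "of_Z2 a = Z2U a 0"

lemma u_square: "u\<^sub>R * u\<^sub>R = 0"
  by (simp add: u\<^sub>R_def times_z2u_def zero_z2u_def)

lemma Z2U_eq: "Z2U r q = of_Z2 r + u\<^sub>R * of_Z2 q"
  by (simp add: u\<^sub>R_def of_Z2_def times_z2u_def plus_z2u_def)

lemma UNIV_z2u: "(UNIV :: z2u set) = {0, 1, u\<^sub>R, 1 + u\<^sub>R}"
proof -
  have "x \<in> {0, 1, u\<^sub>R, 1 + u\<^sub>R}" for x :: z2u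
  proof (cases x)
    case (Z2U r q)
    then show ?thesis
      by (cases r; cases q) (simp_all add: zero_z2u_def one_z2u_def u\<^sub>R_def plus_z2u_def)
  qed
  then show ?thesis by blast
qed

lemma eta_simps [simp]:
  "eta (x + y) = eta x + eta y" "eta (x * y) = eta x * eta y" "eta 0 = 0" "eta 1 = 1"
  by (simp_all add: plus_z2u_def times_z2u_def zero_z2u_def one_z2u_def)


section \<open>General module constructions\<close>

text \<open>The quotient \<open>R/I\<close> by an ideal, as an \<open>R\<close>-module: the coset \<open>x + I\<close> is sent by \<open>r\<close>
  to \<open>rx + I\<close>.\<close>

definition quot_module :: "'a ring \<Rightarrow> 'a set \<Rightarrow> ('a, 'a set) module" where
  "quot_module R I = ring.extend (R Quot I)
     (module.fields (\<lambda>r X. \<Union>x\<in>X. I +>\<^bsub>R\<^esub> (r \<otimes>\<^bsub>R\<^esub> x)))"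

text \<open>The multiplicative fields \<open>mult\<close> and \<open>one\<close> of a module record are irrelevant.\<close>

definition power_module :: "('a, 'b) module \<Rightarrow> nat \<Rightarrow> ('a, nat \<Rightarrow> 'b) module" where
  "power_module M n =
    \<lparr>carrier = {..<n} \<rightarrow>\<^sub>E carrier M,
     mult = undefined, one = undefined,
     zero = (\<lambda>i\<in>{..<n}. \<zero>\<^bsub>M\<^esub>),
     add = (\<lambda>f g. \<lambda>i\<in>{..<n}. f i \<oplus>\<^bsub>M\<^esub> g i),
     smult = (\<lambda>r f. \<lambda>i\<in>{..<n}. r \<odot>\<^bsub>M\<^esub> f i)\<rparr>"

definition mod_isomorphic ::
    "'a ring \<Rightarrow> ('a, 'b) module \<Rightarrow> ('a, 'c) module \<Rightarrow> bool" where
  "mod_isomorphic R M N \<longleftrightarrow>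
     (\<exists>f. mod_hom R M N f \<and> bij_betw f (carrier M) (carrier N))"

lemma quot_module_simps [simp]:
  "carrier (quot_module R I) = a_rcosets\<^bsub>R\<^esub> I"
  "zero (quot_module R I) = I"
  "add (quot_module R I) = set_add R"
  "smult (quot_module R I) = (\<lambda>r X. \<Union>x\<in>X. I +>\<^bsub>R\<^esub> (r \<otimes>\<^bsub>R\<^esub> x))"
  by (simp_all add: quot_module_def ring.extend_def module.fields_def FactRing_def)

lemma power_module_simps [simp]:
  "carrier (power_module M n) = {..<n} \<rightarrow>\<^sub>E carrier M"
  "zero (power_module M n) = (\<lambda>i\<in>{..<n}. \<zero>\<^bsub>M\<^esub>)"
  "add (power_module M n) = (\<lambda>f g. \<lambda>i\<in>{..<n}. f i \<oplus>\<^bsub>M\<^esub> g i)"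
  "smult (power_module M n) = (\<lambda>r f. \<lambda>i\<in>{..<n}. r \<odot>\<^bsub>M\<^esub> f i)"
  by (simp_all add: power_module_def)

lemma quot_module_smult:
  assumes "ideal I R" "cring R" "r \<in> carrier R" "x \<in> carrier R"
  shows "r \<odot>\<^bsub>quot_module R I\<^esub> (I +>\<^bsub>R\<^esub> x) = I +>\<^bsub>R\<^esub> (r \<otimes>\<^bsub>R\<^esub> x)"
proof -
  interpret R: cring R by fact
  interpret ideal I R by fact
  have eq: "I +>\<^bsub>R\<^esub> (r \<otimes>\<^bsub>R\<^esub> y) = I +>\<^bsub>R\<^esub> (r \<otimes>\<^bsub>R\<^esub> x)" if y: "y \<in> I +>\<^bsub>R\<^esub> x" for y
  proof -
    obtain i where i: "i \<in> I" "y = i \<oplus>\<^bsub>R\<^esub> x"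
      using y by (auto simp: a_r_coset_def')
    have "r \<otimes>\<^bsub>R\<^esub> y = (r \<otimes>\<^bsub>R\<^esub> i) \<oplus>\<^bsub>R\<^esub> (r \<otimes>\<^bsub>R\<^esub> x)"
      using i assms by (simp add: R.r_distr)
    moreover have "r \<otimes>\<^bsub>R\<^esub> i \<in> I"
      using i assms by (simp add: I_l_closed)
    ultimately have "r \<otimes>\<^bsub>R\<^esub> y \<in> I +>\<^bsub>R\<^esub> (r \<otimes>\<^bsub>R\<^esub> x)"
      by (auto simp: a_r_coset_def')
    then show ?thesis
      using a_repr_independence' assms by simp
  qed
  moreover have "x \<in> I +>\<^bsub>R\<^esub> x"
    by (simp add: a_rcos_self assms)
  ultimately show ?thesis
    unfolding quot_module_simps by (intro equalityI UN_least) blast+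
qed

lemma quot_module_is_module:
  assumes "ideal I R" "cring R"
  shows "Module.module R (quot_module R I)"
proof -
  interpret R: cring R by fact
  interpret ideal I R by fact
  interpret Q: ring "R Quot I" by (rule quotient_is_ring)
  note sm = quot_module_smult[OF assms]
  note [simp del] = quot_module_simps(4)
  have add: "(I +>\<^bsub>R\<^esub> x) <+>\<^bsub>R\<^esub> (I +>\<^bsub>R\<^esub> y) = I +>\<^bsub>R\<^esub> (x \<oplus>\<^bsub>R\<^esub> y)"
    if "x \<in> carrier R" "y \<in> carrier R" for x y
    using that by (rule a_rcos_sum)
  have car: "X \<in> a_rcosets\<^bsub>R\<^esub> I \<longleftrightarrow> (\<exists>x\<in>carrier R. X = I +>\<^bsub>R\<^esub> x)" for X
    by (auto simp: A_RCOSETS_def')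
  have "abelian_group (quot_module R I)"
  proof (rule abelian_groupI, goal_cases)
    case (1 x y) then show ?case using Q.a_closed[of x y] by (simp add: FactRing_def)
  next
    case 2 then show ?case using Q.zero_closed by (simp add: FactRing_def)
  next
    case (3 x y z) then show ?case using Q.a_assoc[of x y z] by (simp add: FactRing_def)
  next
    case (4 x y) then show ?case using Q.a_comm[of x y] by (simp add: FactRing_def)
  next
    case (5 x) then show ?case using Q.l_zero[of x] by (simp add: FactRing_def)
  next
    case (6 x) then show ?case using Q.a_inv_closed[of x] Q.l_neg[of x]
      by (auto simp: FactRing_def)
  qed
  then show ?thesis
  proof (rule moduleI[OF assms(2)], goal_cases)
    case (1 a x) then show ?case by (auto simp: car sm)
  next
    case (2 a b x) then show ?case by (auto simp: car sm add R.l_distr)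
  next
    case (3 a x y) then show ?case by (auto simp: car sm add R.r_distr)
  next
    case (4 a b x) then show ?case by (auto simp: car sm R.m_assoc)
  next
    case (5 x) then show ?case by (auto simp: car sm)
  qed
qed

lemma power_module_is_module:
  assumes "Module.module R M"
  shows "Module.module R (power_module M n)"
proof -
  interpret Module.module R M by fact
  have "abelian_group (power_module M n)"
  proof (rule abelian_groupI, goal_cases)
    case (6 x)
    then show ?case
      by (intro bexI[of _ "\<lambda>i\<in>{..<n}. \<ominus>\<^bsub>M\<^esub> x i"]) (auto simp: M.l_neg PiE_iff intro!: restrict_ext)
  next
    case (5 x)
    then show ?case by (auto simp: fun_eq_iff PiE_iff extensional_def)
  qed (auto simp: M.a_ac PiE_iff intro!: restrict_ext)
  then show ?thesis
  proof (rule moduleI[OF R.is_cring], goal_cases)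
    case (5 x)
    then show ?case by (auto simp: fun_eq_iff PiE_iff extensional_def)
  qed (auto simp: PiE_iff smult_l_distr smult_r_distr smult_assoc1 intro!: restrict_ext)
qed


section \<open>\<open>\<int>\<^sub>2R\<close>-linear codes\<close>

text \<open>\<open>\<int>\<^sub>2\<^sup>\<alpha>\<close> as an \<open>R\<close>-module via \<open>eta\<close>.\<close>

definition Z2_vec_module :: "nat \<Rightarrow> (z2u, bit vec) module" where
  "Z2_vec_module \<alpha> =
    \<lparr>carrier = carrier_vec \<alpha>,
     mult = undefined, one = undefined,
     zero = 0\<^sub>v \<alpha>,
     add = (+),
     smult = (\<lambda>d v. eta d \<cdot>\<^sub>v v)\<rparr>"

definition Z2R_module :: "nat \<Rightarrow> nat \<Rightarrow> (z2u, bit vec \<times> z2u vec) module" where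
  "Z2R_module \<alpha> \<beta> = direct_sum (Z2_vec_module \<alpha>) (module_vec TYPE(z2u) \<beta>)"

definition Z2R_linear_code :: "nat \<Rightarrow> nat \<Rightarrow> (bit vec \<times> z2u vec) set \<Rightarrow> bool" where
  "Z2R_linear_code \<alpha> \<beta> C \<longleftrightarrow> submodule class_ring C (Z2R_module \<alpha> \<beta>)"

definition subcode_b :: "(bit vec \<times> z2u vec) set \<Rightarrow> (bit vec \<times> z2u vec) set" where
  "subcode_b C = {c \<in> C. \<forall>j < dim_vec (snd c). snd c $ j \<in> {0, u\<^sub>R}}"

text \<open>For \<open>\<alpha> = 0\<close> the dimension below is that of the zero space (see \<open>kappa_0\<close>), so the
  convention \<open>\<kappa> = 0\<close> in that case needs no separate clause.\<close>

definition kappa :: "nat \<Rightarrow> (bit vec \<times> z2u vec) set \<Rightarrow> nat" where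
  "kappa \<alpha> C = vectorspace.dim class_ring
     (module_vec TYPE(bit) \<alpha> \<lparr>carrier := fst ` subcode_b C\<rparr>)"

definition has_type ::
    "(bit vec \<times> z2u vec) set \<Rightarrow> nat \<Rightarrow> nat \<Rightarrow> nat \<Rightarrow> nat \<Rightarrow> nat \<Rightarrow> bool" where
  "has_type C \<alpha> \<beta> \<gamma> \<delta> \<kappa> \<longleftrightarrow>
     Z2R_linear_code \<alpha> \<beta> C \<and>
     mod_isomorphic class_ring (Z2R_module \<alpha> \<beta> \<lparr>carrier := C\<rparr>)
       (direct_sum (power_module (quot_module class_ring (PIdl\<^bsub>class_ring\<^esub> u\<^sub>R)) \<gamma>)
                   (module_vec TYPE(z2u) \<delta>)) \<and>
     \<kappa> = kappa \<alpha> C"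

fun Z2R_inner :: "bit vec \<times> z2u vec \<Rightarrow> bit vec \<times> z2u vec \<Rightarrow> z2u" where
  "Z2R_inner (v, w) (x, y) = u\<^sub>R * of_Z2 (v \<bullet> x) + w \<bullet> y"

definition Z2R_dual ::
    "nat \<Rightarrow> nat \<Rightarrow> (bit vec \<times> z2u vec) set \<Rightarrow> (bit vec \<times> z2u vec) set" where
  "Z2R_dual \<alpha> \<beta> C =
     {x \<in> carrier (Z2R_module \<alpha> \<beta>). \<forall>c \<in> C. Z2R_inner c x = 0}"

definition Z2R_self_dual :: "nat \<Rightarrow> nat \<Rightarrow> (bit vec \<times> z2u vec) set \<Rightarrow> bool" where
  "Z2R_self_dual \<alpha> \<beta> C \<longleftrightarrow> C = Z2R_dual \<alpha> \<beta> C"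

lemma Z2R_module_simps:
  "carrier (Z2R_module \<alpha> \<beta>) = carrier_vec \<alpha> \<times> carrier_vec \<beta>"
  "zero (Z2R_module \<alpha> \<beta>) = (0\<^sub>v \<alpha>, 0\<^sub>v \<beta>)"
  "add (Z2R_module \<alpha> \<beta>) = (\<lambda>c c'. (fst c + fst c', snd c + snd c'))"
  "smult (Z2R_module \<alpha> \<beta>) = (\<lambda>d c. (eta d \<cdot>\<^sub>v fst c, d \<cdot>\<^sub>v snd c))"
  by (simp_all add: Z2R_module_def direct_sum_def Z2_vec_module_def module_vec_simps)

lemma Z2_vec_module_is_module: "Module.module class_ring (Z2_vec_module \<alpha>)"
proof -
  have "abelian_group (Z2_vec_module \<alpha>)"
  proof (rule abelian_groupI, goal_cases)
    case (6 x) then show ?case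
      by (intro bexI[of _ "- x"]) (auto simp: Z2_vec_module_def uminus_l_inv_vec)
  qed (auto simp: Z2_vec_module_def intro: assoc_add_vec comm_add_vec)
  then show ?thesis
    by (intro moduleI class_cring.is_cring)
      (auto simp: Z2_vec_module_def add_smult_distrib_vec smult_add_distrib_vec smult_smult_assoc)
qed

lemma Z2R_module_is_module: "Module.module class_ring (Z2R_module \<alpha> \<beta>)"
proof -
  interpret V: vec_module "TYPE(z2u)" \<beta> .
  show ?thesis
    unfolding Z2R_module_def
    by (intro direct_sum_is_module Z2_vec_module_is_module V.module_axioms)
qed

lemma kappa_0:
  assumes "Z2R_linear_code 0 \<beta> C"
  shows "kappa 0 C = 0"
proof -
  interpret submodule class_ring C "Z2R_module 0 \<beta>"
    using assms by (simp add: Z2R_linear_code_def)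
  have "(0\<^sub>v 0, 0\<^sub>v \<beta>) \<in> subcode_b C"
    using zero_closed by (auto simp: subcode_b_def Z2R_module_simps)
  then have "0\<^sub>v 0 \<in> fst ` subcode_b C"
    by (metis fst_conv image_eqI)
  moreover have "v = 0\<^sub>v 0" if "(v, w) \<in> C" for v w
  proof -
    have "v \<in> carrier_vec 0"
      using subset that by (auto simp: Z2R_module_simps)
    then show ?thesis
      by (intro eq_vecI) auto
  qed
  then have "fst ` subcode_b C \<subseteq> {0\<^sub>v 0}"
    unfolding subcode_b_def by auto
  ultimately have eq: "fst ` subcode_b C = {0\<^sub>v 0}"
    by blast
  interpret V: vec_space "TYPE(bit)" 0 .
  note [simp del] = add_bit_eq_xor mult_bit_eq_and
  have span: "V.span {} = {0\<^sub>v 0}"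
    using V.span_empty by simp
  interpret W: vectorspace class_ring "V.vs {0\<^sub>v 0}"
    using V.subspace_is_vs[OF V.span_is_subspace[of "{}"]] unfolding span by simp
  have "W.span {} = {0\<^sub>v 0}"
    using W.span_empty by (simp add: module_vec_simps)
  then have "W.dim = 0"
    unfolding W.dim_def by (intro Least_equality) (auto intro!: exI[of _ "{}"])
  then show ?thesis
    unfolding kappa_def eq .
qed

end

theory Submission
  imports Defs
begin

text \<open>For \<open>\<alpha> = 2m\<close> take the code of all \<open>((x, x), uy)\<close> with \<open>x \<in> \<int>\<^sub>2\<^sup>m\<close> and \<open>y \<in> \<int>\<^sub>2\<^sup>\<beta>\<close>. It is
  annihilated by \<open>u\<close>, so it is isomorphic to \<open>(R/uR)\<^sup>m\<^sup>+\<^sup>\<beta>\<close>. It is self-orthogonal since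
  \<open>2 = u\<^sup>2 = 0\<close>, and testing a dual vector against \<open>((e\<^sub>i, e\<^sub>i), 0)\<close> and \<open>(0, ue\<^sub>j)\<close> shows that
  it lies in the code.\<close>

text \<open>Keeps bits in ring notation, so that the general laws for sums and products apply to
  them.\<close>

declare add_bit_eq_xor [simp del] mult_bit_eq_and [simp del]

section \<open>Arithmetic in the ring R\<close>

lemma bit_add_eq_0_iff: "a + b = 0 \<longleftrightarrow> a = b" for a b :: bit
  by (cases a; cases b) simp_all

lemma z2u_eq_iff: "x = y \<longleftrightarrow> eta x = eta y \<and> ucoeff x = ucoeff y"
  by (cases x; cases y) simp

lemma z2u_coeff_simps:
  "eta (x - y) = eta x - eta y" "ucoeff 0 = 0" "ucoeff (x + y) = ucoeff x + ucoeff y"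
  "ucoeff (x * y) = eta x * ucoeff y + ucoeff x * eta y"
  by (simp_all add: zero_z2u_def plus_z2u_def minus_z2u_def times_z2u_def)

lemma of_Z2_simps [simp]: "eta (of_Z2 a) = a" "ucoeff (of_Z2 a) = 0"
  by (simp_all add: of_Z2_def)

lemma u_simps [simp]: "eta u\<^sub>R = 0" "ucoeff u\<^sub>R = 1"
  by (simp_all add: u\<^sub>R_def)

text \<open>Both factors are multiples of u, and u squared is 0.\<close>

lemma mult_eq_0_if_eta_eq_0:
  assumes "eta x = 0" "eta y = 0"
  shows "x * y = 0"
  using assms by (simp add: z2u_eq_iff z2u_coeff_simps)

text \<open>Multiplication by u moves \<open>eta x\<close> into the u-coefficient and discards the
  rest, so the annihilator of u is uR.\<close>

lemma u_times_eq_0_iff: "u\<^sub>R * x = 0 \<longleftrightarrow> eta x = 0"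
  by (simp add: z2u_eq_iff z2u_coeff_simps)

section \<open>The module R/uR\<close>

text \<open>The ideal uR is the kernel of \<open>eta\<close>, so its cosets are the fibres of
  \<open>eta\<close>; a bit serves as the name of a coset.\<close>

definition residue :: "bit \<Rightarrow> z2u set" where
  "residue b = {x. eta x = b}"

lemma inj_residue: "inj residue"
proof (rule injI)
  fix a b
  assume "residue a = residue b"
  moreover have "of_Z2 a \<in> residue a"
    by (simp add: residue_def)
  ultimately show "a = b"
    by (simp add: residue_def)
qed

lemma u_ideal_eq: "PIdl\<^bsub>class_ring\<^esub> u\<^sub>R = residue 0"
proof -
  have "x = of_Z2 (ucoeff x) * u\<^sub>R" if "eta x = 0" for x
    using that by (simp add: z2u_eq_iff z2u_coeff_simps)
  then show ?thesis
    by (auto simp: cgenideal_def residue_def)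
qed

lemma residue_coset: "residue 0 +>\<^bsub>class_ring\<^esub> x = residue (eta x)"
proof -
  have "y \<in> residue 0 +>\<^bsub>class_ring\<^esub> x" if "eta y = eta x" for y
    using that unfolding a_r_coset_def'
    by (auto simp: residue_def z2u_coeff_simps intro!: exI[of _ "y - x"])
  then show ?thesis
    by (auto simp: a_r_coset_def' residue_def)
qed

lemma residue_add: "residue a <+>\<^bsub>class_ring\<^esub> residue b = residue (a + b)"
proof -
  have "\<exists>x z. eta x = a \<and> eta z = b \<and> y = x + z" if "eta y = a + b" for y
    using that by (intro exI[of _ "of_Z2 a"] exI[of _ "y - of_Z2 a"]) (simp add: z2u_coeff_simps)
  then show ?thesis
    by (auto simp: set_add_def' residue_def)
qed

abbreviation residue_module :: "(z2u, z2u set) module" where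
  "residue_module \<equiv> quot_module class_ring (PIdl\<^bsub>class_ring\<^esub> u\<^sub>R)"

text \<open>Identifies R/uR with the bits, on which R acts through \<open>eta\<close>. Later
  computations use these rules in place of the unfolded quotient.\<close>

lemma residue_module_simps:
  "carrier residue_module = range residue"
  "residue a \<oplus>\<^bsub>residue_module\<^esub> residue b = residue (a + b)"
  "r \<odot>\<^bsub>residue_module\<^esub> residue b = residue (eta r * b)"
proof -
  \<comment> \<open>Exhibits each fibre as the coset of a concrete element;
    \<open>of_Z2_simps\<close> is switched off below because it would make this fact
    trivial.\<close>
  have "residue b = residue (eta (of_Z2 b))" for b
    by simp
  then show "carrier residue_module = range residue"
    by (auto simp: A_RCOSETS_def' u_ideal_eq residue_coset simp del: of_Z2_simps)
  show "residue a \<oplus>\<^bsub>residue_module\<^esub> residue b = residue (a + b)"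
    by (simp add: residue_add)
  \<comment> \<open>Scalar multiplication in the quotient is a union over the coset. All its members
    are equal, so only nonemptiness of the coset remains.\<close>
  have "of_Z2 b \<in> residue b"
    by (simp add: residue_def)
  then show "r \<odot>\<^bsub>residue_module\<^esub> residue b = residue (eta r * b)"
    by (auto simp: u_ideal_eq residue_coset) (auto simp: residue_def)
qed

lemma residue_module_is_module: "Module.module class_ring residue_module"
  by (intro quot_module_is_module cring.cgenideal_ideal class_cring.is_cring) simp

section \<open>The code and its self-duality\<close>

text \<open>Given by equations rather than as the image of (x, y), so that closure under the module
  operations is checked coordinatewise.\<close>

definition repetition_code :: "nat \<Rightarrow> nat \<Rightarrow> (bit vec \<times> z2u vec) set" where
  "repetition_code m \<beta> = {(v, w). v \<in> carrier_vec (2 * m) \<and> w \<in> carrier_vec \<beta> \<and>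
     (\<forall>i<m. v $ (m + i) = v $ i) \<and> (\<forall>j<\<beta>. eta (w $ j) = 0)}"

lemma repetition_code_linear: "Z2R_linear_code (2 * m) \<beta> (repetition_code m \<beta>)"
  unfolding Z2R_linear_code_def
  by (rule submodule.intro[OF Z2R_module_is_module])
    (auto simp: Z2R_module_simps repetition_code_def)

text \<open>Pairs the coordinates \<open>i\<close> and \<open>m + i\<close>. Only \<open>v\<close>
  is a repetition here, so the formula also applies to an arbitrary dual vector \<open>x\<close>;
  over the bits, the factor in brackets vanishes exactly where the halves of \<open>x\<close>
  agree.\<close>

lemma scalar_prod_double:
  fixes v x :: "'a :: semiring_0 vec"
  assumes "v \<in> carrier_vec (2 * m)" "x \<in> carrier_vec (2 * m)"
    and "\<And>i. i < m \<Longrightarrow> v $ (m + i) = v $ i"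
  shows "v \<bullet> x = (\<Sum>i<m. v $ i * (x $ i + x $ (m + i)))"
proof -
  have split: "(\<Sum>i<m + n. f i) = (\<Sum>i<m. f i) + (\<Sum>i<n. f (m + i))" 
    for n and f :: "nat \<Rightarrow> 'a"
    by (induction n) (simp_all add: add.assoc)
  have "v \<bullet> x = (\<Sum>i<m + m. v $ i * x $ i)"
    using assms by (simp add: scalar_prod_def atLeast0LessThan mult_2)
  also have "\<dots> = (\<Sum>i<m. v $ i * x $ i) + (\<Sum>i<m. v $ (m + i) * x $ (m + i))"
    by (rule split)
  also have "\<dots> = (\<Sum>i<m. v $ i * (x $ i + x $ (m + i)))"
    using assms by (simp add: distrib_left sum.distrib)
  finally show ?thesis .
qed

lemma repetition_code_self_dual: "Z2R_self_dual (2 * m) \<beta> (repetition_code m \<beta>)"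
proof -
  have "c \<in> Z2R_dual (2 * m) \<beta> (repetition_code m \<beta>)" if "c \<in> repetition_code m \<beta>" for c
  proof -
    obtain x y where c: "c = (x, y)" by (cases c)
    have x: "x \<in> carrier_vec (2 * m)" "\<And>i. i < m \<Longrightarrow> x $ (m + i) = x $ i"
      and y: "y \<in> carrier_vec \<beta>" "\<And>j. j < \<beta> \<Longrightarrow> eta (y $ j) = 0"
      using that by (auto simp: c repetition_code_def)
    have "Z2R_inner (v, w) (x, y) = 0" if vw: "(v, w) \<in> repetition_code m \<beta>" for v w
    proof -
      have "v \<bullet> x = (\<Sum>i<m. v $ i * (x $ i + x $ (m + i)))"
        using vw x by (intro scalar_prod_double) (auto simp: repetition_code_def)
      also have "\<dots> = 0"
        using x by (intro sum.neutral) (simp add: bit_add_eq_0_iff[THEN iffD2])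
      finally have "v \<bullet> x = 0" .
      moreover have "w \<bullet> y = 0"
        unfolding scalar_prod_def using vw y
        by (intro sum.neutral ballI mult_eq_0_if_eta_eq_0) (auto simp: repetition_code_def)
      ultimately show ?thesis
        by (simp add: of_Z2_def zero_z2u_def times_z2u_def)
    qed
    then show ?thesis
      using x y by (auto simp: c Z2R_dual_def Z2R_module_simps)
  qed
  moreover have "c \<in> repetition_code m \<beta>" if "c \<in> Z2R_dual (2 * m) \<beta> (repetition_code m \<beta>)" for c
  proof -
    obtain x y where c: "c = (x, y)" by (cases c)
    have x: "x \<in> carrier_vec (2 * m)" and y: "y \<in> carrier_vec \<beta>"
      and orth: "\<And>v w. (v, w) \<in> repetition_code m \<beta> \<Longrightarrow> u\<^sub>R * of_Z2 (v \<bullet> x) + w \<bullet> y = 0"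
      using that by (auto simp: c Z2R_dual_def Z2R_module_simps)
    have "x $ (m + i) = x $ i" if i: "i < m" for i
    proof -
      define v :: "bit vec" where "v = vec (2 * m) (\<lambda>k. of_bool (k = i \<or> k = m + i))"
      have "(v, 0\<^sub>v \<beta>) \<in> repetition_code m \<beta>"
        using i by (auto simp: repetition_code_def v_def)
      from orth[OF this] have "v \<bullet> x = 0"
        using y by (simp add: u_times_eq_0_iff)
      moreover have "v \<bullet> x = (\<Sum>k<m. v $ k * (x $ k + x $ (m + k)))"
        using x by (intro scalar_prod_double) (use i in \<open>auto simp: v_def\<close>)
      \<comment> \<open>The index \<open>m + i\<close> of the second 1 in \<open>v\<close> lies
        outside the range of summation.\<close>
      moreover have "\<dots> = (\<Sum>k<m. if k = i then x $ k + x $ (m + k) else 0)"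
        using i by (intro sum.cong) (auto simp: v_def)
      ultimately show ?thesis
        using i by (simp add: bit_add_eq_0_iff)
    qed
    moreover have "eta (y $ j) = 0" if j: "j < \<beta>" for j
    proof -
      have "(0\<^sub>v (2 * m), u\<^sub>R \<cdot>\<^sub>v unit_vec \<beta> j) \<in> repetition_code m \<beta>"
        using j by (auto simp: repetition_code_def)
      from orth[OF this] have "u\<^sub>R * y $ j = 0"
        \<comment> \<open>Unfolding \<open>of_Z2\<close> leaves \<open>Z2U 0 0\<close>, which the
          reversed \<open>zero_z2u_def\<close> folds back to 0.\<close>
        using x y j by (simp add: of_Z2_def flip: zero_z2u_def)
      then show ?thesis
        by (simp add: u_times_eq_0_iff)
    qed
    ultimately show ?thesis
      using x y by (auto simp: c repetition_code_def)
  qed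
  ultimately show ?thesis
    unfolding Z2R_self_dual_def by blast
qed

section \<open>The type of the code\<close>

text \<open>The m + \<beta> free bits of a codeword: the first half of the binary part, then the
  u-coefficients.\<close>

definition code_coord :: "nat \<Rightarrow> bit vec \<times> z2u vec \<Rightarrow> nat \<Rightarrow> bit" where
  "code_coord m c i = (if i < m then fst c $ i else ucoeff (snd c $ (i - m)))"

lemma code_coord_add:
  assumes "c \<in> repetition_code m \<beta>" "d \<in> repetition_code m \<beta>" "i < m + \<beta>"
  shows "code_coord m (fst c + fst d, snd c + snd d) i = code_coord m c i + code_coord m d i"
  using assms by (auto simp: repetition_code_def code_coord_def z2u_coeff_simps)

text \<open>The u-coefficient of a product also contains \<open>ucoeff r\<close> times the
  \<open>eta\<close> of the entry, which is 0 on the code. Hence R acts through \<open>eta\<close>,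
  as on R/uR.\<close>

lemma code_coord_smult:
  assumes "c \<in> repetition_code m \<beta>" "i < m + \<beta>"
  shows "code_coord m (eta r \<cdot>\<^sub>v fst c, r \<cdot>\<^sub>v snd c) i = eta r * code_coord m c i"
  using assms by (auto simp: repetition_code_def code_coord_def z2u_coeff_simps)

text \<open>The other bits are forced: the second half repeats the first, and every
  \<open>eta\<close> in the R-part is 0.\<close>

lemma repetition_code_eqI:
  assumes "c \<in> repetition_code m \<beta>" "d \<in> repetition_code m \<beta>"
    and eq: "\<And>i. i < m + \<beta> \<Longrightarrow> code_coord m c i = code_coord m d i"
  shows "c = d"
proof (rule prod_eqI)
  have fst_low: "fst c $ i = fst d $ i" if "i < m" for i
    using that eq[of i] by (simp add: code_coord_def)
  have "fst c $ i = fst d $ i" if i: "i < 2 * m" for i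
  proof (cases "i < m")
    case False
    then obtain k where "i = m + k"
      using le_Suc_ex not_less by blast
    moreover from this have "k < m"
      using i by simp
    ultimately show ?thesis
      using assms(1,2) fst_low[of k] by (auto simp: repetition_code_def)
  qed (rule fst_low)
  then show "fst c = fst d"
    using assms(1,2) by (intro eq_vecI) (auto simp: repetition_code_def)
  have "snd c $ j = snd d $ j" if "j < \<beta>" for j
    using assms(1,2) that eq[of "m + j"]
    by (auto simp: repetition_code_def code_coord_def z2u_eq_iff)
  then show "snd c = snd d"
    using assms(1,2) by (intro eq_vecI) (auto simp: repetition_code_def)
qed

lemma repetition_code_of_coord:
  obtains c where "c \<in> repetition_code m \<beta>" "\<And>i. i < m + \<beta> \<Longrightarrow> code_coord m c i = g i"
proof
  let ?c = "(vec (2 * m) (\<lambda>i. g (if i < m then i else i - m)), vec \<beta> (\<lambda>j. Z2U 0 (g (m + j))))"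
  show "?c \<in> repetition_code m \<beta>"
    by (auto simp: repetition_code_def)
  show "code_coord m ?c i = g i" if "i < m + \<beta>" for i
    using that by (auto simp: code_coord_def)
qed

text \<open>Each free bit contributes one copy of R/uR. There is no free summand, so the second
  factor is the one-element module of vectors of length 0.\<close>

lemma repetition_code_isomorphic:
  "mod_isomorphic class_ring (Z2R_module (2 * m) \<beta>\<lparr>carrier := repetition_code m \<beta>\<rparr>)
     (direct_sum (power_module residue_module (m + \<beta>)) (module_vec TYPE(z2u) 0))"
    (is "mod_isomorphic _ ?M ?N")
proof -
  define f where "f c = (\<lambda>i\<in>{..<m + \<beta>}. residue (code_coord m c i), 0\<^sub>v 0 :: z2u vec)" for c
  interpret Z: Module.module class_ring "Z2R_module (2 * m) \<beta>"
    by (rule Z2R_module_is_module)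
  interpret V: vec_module "TYPE(z2u)" 0 .
  have carrier_N: "carrier ?N = ({..<m + \<beta>} \<rightarrow>\<^sub>E range residue) \<times> carrier_vec 0"
    and add_N: "x \<oplus>\<^bsub>?N\<^esub> y =
      (\<lambda>i\<in>{..<m + \<beta>}. fst x i \<oplus>\<^bsub>residue_module\<^esub> fst y i, snd x + snd y)"
    and smult_N: "r \<odot>\<^bsub>?N\<^esub> x =
      (\<lambda>i\<in>{..<m + \<beta>}. r \<odot>\<^bsub>residue_module\<^esub> fst x i, r \<cdot>\<^sub>v snd x)" for x y r
    by (simp_all add: direct_sum_def module_vec_simps residue_module_simps(1)
        del: quot_module_simps)
  have f_closed: "f c \<in> carrier ?N" for c
    by (auto simp: f_def carrier_N)
  have f_add: "f (fst c + fst d, snd c + snd d) = f c \<oplus>\<^bsub>?N\<^esub> f d"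
    if "c \<in> repetition_code m \<beta>" "d \<in> repetition_code m \<beta>" for c d
    unfolding add_N f_def fst_conv snd_conv
    by (intro arg_cong2[of _ _ _ _ Pair] restrict_ext)
      (use that in \<open>simp_all add: residue_module_simps code_coord_add[of _ _ \<beta>]
        del: quot_module_simps\<close>)
  have smult_0: "r \<cdot>\<^sub>v 0\<^sub>v 0 = 0\<^sub>v 0" for r :: z2u
    by (intro eq_vecI) auto
  have f_smult: "f (eta r \<cdot>\<^sub>v fst c, r \<cdot>\<^sub>v snd c) = r \<odot>\<^bsub>?N\<^esub> f c"
    if "c \<in> repetition_code m \<beta>" for r c
    unfolding smult_N f_def fst_conv snd_conv
    by (intro arg_cong2[of _ _ _ _ Pair] restrict_ext smult_0[symmetric])
      (use that in \<open>simp_all add: residue_module_simps code_coord_smult[of _ _ \<beta>]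
        del: quot_module_simps\<close>)
  have "f \<in> LinearCombinations.module_hom class_ring ?M ?N"
    unfolding LinearCombinations.module_hom_def
    using f_closed f_add f_smult by (simp add: Z2R_module_simps del: split_paired_All)
  moreover have "Module.module class_ring ?M"
    using Z.submodule_is_module repetition_code_linear by (simp add: Z2R_linear_code_def)
  moreover have "Module.module class_ring ?N"
    by (intro direct_sum_is_module power_module_is_module residue_module_is_module
        V.module_axioms)
  ultimately have "mod_hom class_ring ?M ?N f"
    by (simp add: mod_hom_def mod_hom_axioms_def)
  moreover have "inj_on f (repetition_code m \<beta>)"
  proof (rule inj_onI)
    fix c d
    assume cd: "c \<in> repetition_code m \<beta>" "d \<in> repetition_code m \<beta>" and eq: "f c = f d"
    have "residue (code_coord m c i) = residue (code_coord m d i)" if "i < m + \<beta>" for i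
      using that arg_cong[OF eq, of "\<lambda>x. fst x i"] by (simp add: f_def)
    then show "c = d"
      using cd by (intro repetition_code_eqI) (auto dest: injD[OF inj_residue])
  qed
  moreover have "f ` repetition_code m \<beta> = carrier ?N"
  proof
    show "f ` repetition_code m \<beta> \<subseteq> carrier ?N"
      by (auto simp: f_def carrier_N)
    show "carrier ?N \<subseteq> f ` repetition_code m \<beta>"
    proof
      fix y assume y: "y \<in> carrier ?N"
      obtain c where c: "c \<in> repetition_code m \<beta>"
        \<comment> \<open>Each component of \<open>fst y\<close> is a fibre of \<open>eta\<close>;
          \<open>inv_into\<close> recovers the bit naming it.\<close>
        and coord: "\<And>i. i < m + \<beta> \<Longrightarrow> code_coord m c i = inv_into UNIV residue (fst y i)"
        using repetition_code_of_coord[of m \<beta> "\<lambda>i. inv_into UNIV residue (fst y i)"] by blast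
      have "fst y i = residue (code_coord m c i)" if "i < m + \<beta>" for i
        using y that by (auto simp: carrier_N coord PiE_iff f_inv_into_f)
      then have "fst y = fst (f c)"
        using y by (intro extensionalityI[of _ "{..<m + \<beta>}"]) (auto simp: f_def carrier_N PiE_iff)
      moreover have "snd y = snd (f c)"
        using y by (intro eq_vecI) (auto simp: f_def carrier_N)
      ultimately show "y \<in> f ` repetition_code m \<beta>"
        using c by (auto intro!: image_eqI[of _ _ c] prod_eqI)
    qed
  qed
  ultimately show ?thesis
    unfolding mod_isomorphic_def bij_betw_def by auto
qed

theorem corollary3p2:
  fixes \<alpha> \<beta> :: nat
  assumes "even \<alpha>"
  shows "\<exists>C. Z2R_linear_code \<alpha> \<beta> C \<and> Z2R_self_dual \<alpha> \<beta> C \<and>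
           (\<exists>\<gamma> \<delta> \<kappa>. has_type C \<alpha> \<beta> \<gamma> \<delta> \<kappa>)"
proof -
  obtain m where "\<alpha> = 2 * m"
    using assms by (rule evenE)
  \<comment> \<open>Here \<gamma> = m + \<beta> and \<delta> = 0; for \<kappa> the defining
    expression itself is the witness.\<close>
  then have "has_type (repetition_code m \<beta>) \<alpha> \<beta> (m + \<beta>) 0 (kappa \<alpha> (repetition_code m \<beta>))"
    unfolding has_type_def
    using repetition_code_linear repetition_code_isomorphic by simp
  with \<open>\<alpha> = 2 * m\<close> show ?thesis
    using repetition_code_linear repetition_code_self_dual by blast
qed

end
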